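(* Let $0<\kappa<c/2$, let $\phi=\phi(\xi;c,\kappa)$ be the solitary wave profile described in the context, and put $h:=2\kappa/(c-\kappa)\in(0,2)$. With $\kappa$ fixed, the condition $$\frac{\mathrm d}{\mathrm dc}Q(\phi,c)>0,\qquad Q(\phi,c):=\int_{\mathbb R}\left(\frac{c-\kappa}{c-\phi}\ln\Big(\frac{c-\kappa}{c-\phi}\Big)-\frac{c-\kappa}{c-\phi}+1\right)\mathrm d\xi ,$$ holds if and only if $$\frac{\mathrm d}{\mathrm dh}\bar Q<0,\qquad \bar Q:=2\int_{\Gamma_h}\frac{\big(-\varphi-\ln(1-\varphi)\big)^{1/2}}{1-\varphi}\,\mathrm d\tau ,$$ where $\Gamma_h$ and the parameter $\tau$ along it are as in the context.
   Context: For $0<\kappa<c/2$, $\phi(\cdot;c,\kappa)\in C^\infty(\mathbb R)$ is the solution, unique up to translation in $\xi$, of $\phi_{\xi\xi}-\phi+\frac{\kappa(c-\kappa)}{c-\phi}=0$ with $\phi(\xi)\to\kappa$ exponentially as $\xi\to\pm\infty$ and $\kappa<\phi(\xi)<c$ for all $\xi$, the translation being fixed by $\phi_\xi(0)=0$. The derivative $\mathrm d/\mathrm dc$ is the total derivative with $\kappa$ fixed. For $h\in(0,2)$, $\Gamma_h$ is the curve $$\Gamma_h:=\Big\{(\varphi,\bar\psi):\ 0<\varphi<1,\ -\bar\psi^2-\frac{\varphi^2}{\varphi+\ln(1-\varphi)}=h\Big\}.$$ It is an arc joining (as limits, $\varphi\to0$) the points $(0,\sqrt{2-h})$ and $(0,-\sqrt{2-h})$,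 and is traversed from the former to the latter by the solution of $$\frac{\mathrm d\varphi}{\mathrm d\tau}=2\bar\psi,\qquad \frac{\mathrm d\bar\psi}{\mathrm d\tau}=-\frac{\varphi f(\varphi)}{(1-\varphi)(-\varphi-\ln(1-\varphi))^2},\qquad f(\varphi):=\varphi+(1-\varphi)\big(\varphi+2\ln(1-\varphi)\big),$$ and $\int_{\Gamma_h}\cdots\,\mathrm d\tau$ is the integral over the whole arc with respect to this parameter $\tau$. The relation to $\phi$ is $\phi=\kappa+(c-\kappa)\varphi$, $\bar\psi=\varphi_\xi/\sqrt{-\varphi-\ln(1-\varphi)}$, $\mathrm d\tau=\tfrac12\sqrt{-\varphi-\ln(1-\varphi)}\,\mathrm d\xi$, with $h=2\kappa/(c-\kappa)$. *)

theory Defs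
  imports "HOL-Analysis.Analysis"
begin

definition smooth :: "(real \<Rightarrow> real) \<Rightarrow> bool" where
  "smooth u \<longleftrightarrow> (\<forall>n x. ((deriv ^^ n) u) differentiable (at x))"

text \<open>The profile of the solitary wave of speed \<open>c\<close> over the background \<open>\<kappa>\<close>. It is only unique
  up to translation; the last conjunct fixes the translation.\<close>

definition solitary_profile :: "real \<Rightarrow> real \<Rightarrow> (real \<Rightarrow> real) \<Rightarrow> bool" where
  "solitary_profile \<kappa> c \<phi> \<longleftrightarrow>
     smooth \<phi> \<and>
     (\<forall>\<xi>. deriv (deriv \<phi>) \<xi> - \<phi> \<xi> + \<kappa> * (c - \<kappa>) / (c - \<phi> \<xi>) = 0) \<and>
     (\<exists>C \<delta>. 0 < \<delta> \<and> (\<forall>\<xi>. \<bar>\<phi> \<xi> - \<kappa>\<bar> \<le> C * exp (- \<delta> * \<bar>\<xi>\<bar>))) \<and>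
     (\<forall>\<xi>. \<kappa> < \<phi> \<xi> \<and> \<phi> \<xi> < c) \<and>
     deriv \<phi> 0 = 0"

definition wave_Q :: "real \<Rightarrow> (real \<Rightarrow> real) \<Rightarrow> real \<Rightarrow> real" where
  "wave_Q \<kappa> \<phi> c =
     (LBINT \<xi>. (c - \<kappa>) / (c - \<phi> \<xi>) * ln ((c - \<kappa>) / (c - \<phi> \<xi>)) - (c - \<kappa>) / (c - \<phi> \<xi>) + 1)"

definition Gamma_curve :: "real \<Rightarrow> (real \<times> real) set" where
  "Gamma_curve h =
     {(p, s). 0 < p \<and> p < 1 \<and> - s\<^sup>2 - p\<^sup>2 / (p + ln (1 - p)) = h}"

definition arc_f :: "real \<Rightarrow> real" where
  "arc_f p = p + (1 - p) * (p + 2 * ln (1 - p))"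

text \<open>The parametrisation \<open>\<tau> \<mapsto> (p \<tau>, s \<tau>)\<close> of the whole arc by the solution of the planar system.
  The parameter interval \<open>(a, b)\<close> is bounded: the first component vanishes at both ends of the arc,
  where it moves with the nonzero speed \<open>2 \<surd>(2 - h)\<close>.\<close>

definition traverses_Gamma ::
    "real \<Rightarrow> real \<Rightarrow> real \<Rightarrow> (real \<Rightarrow> real) \<Rightarrow> (real \<Rightarrow> real) \<Rightarrow> bool" where
  "traverses_Gamma h a b p s \<longleftrightarrow>
     a < b \<and>
     (\<lambda>\<tau>. (p \<tau>, s \<tau>)) ` {a<..<b} = Gamma_curve h \<and>
     (\<forall>\<tau>\<in>{a<..<b}.
        (p has_real_derivative 2 * s \<tau>) (at \<tau>) \<and>
        (s has_real_derivative
           - (p \<tau> * arc_f (p \<tau>)) / ((1 - p \<tau>) * (- p \<tau> - ln (1 - p \<tau>))\<^sup>2)) (at \<tau>)) \<and>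
     (p \<longlongrightarrow> 0) (at_right a) \<and> (s \<longlongrightarrow> sqrt (2 - h)) (at_right a) \<and>
     (p \<longlongrightarrow> 0) (at_left b) \<and> (s \<longlongrightarrow> - sqrt (2 - h)) (at_left b)"

definition Q_bar :: "real \<Rightarrow> real \<Rightarrow> (real \<Rightarrow> real) \<Rightarrow> real" where
  "Q_bar a b p =
     2 * (LBINT \<tau>:{a<..<b}. sqrt (- p \<tau> - ln (1 - p \<tau>)) / (1 - p \<tau>))"

end

theory Submission
  imports Defs
begin

text \<open>The two functionals are the same quantity in different parametrisations:
  \<open>wave_Q \<kappa> (\<phi> c) c\<close> equals \<open>Q_bar\<close> at \<open>h = 2 * \<kappa> / (c - \<kappa>)\<close>. For fixed \<open>\<kappa>\<close> this \<open>h\<close> is a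
  decreasing diffeomorphism of \<open>c\<close>, from the speeds above \<open>2 * \<kappa>\<close> onto the interval from \<open>0\<close> to
  \<open>2\<close>. By the chain rule, applied in both directions, one function is differentiable exactly when the
  other is, and the derivatives have opposite signs.

  The equality holds because both functionals are integrals along the same orbit of the rescaled wave
  \<open>(\<phi> - \<kappa>) / (c - \<kappa>)\<close>, once with respect to \<open>\<xi>\<close> and once with respect to \<open>\<tau>\<close>. Instead of relating
  \<open>\<xi>\<close> and \<open>\<tau>\<close> directly, which would need uniqueness for the differential equations, each integral is
  expressed in the amplitude \<open>y\<close>. The velocity is an explicit function of the amplitude: for the arc by
  the equation of \<open>Gamma_curve\<close>, for the wave by conservation of energy together with decay at infinity.
  It vanishes only at the amplitude \<open>m\<close> with \<open>m\<^sup>2 = h * (- m - ln (1 - m))\<close>, which is unique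
  (\<open>crest_unique\<close>), and there the acceleration is negative because \<open>arc_f\<close> is positive. So either
  parametrisation rises once from \<open>0\<close> to \<open>m\<close> and falls once back to \<open>0\<close>, and substitution on the two
  flanks (\<open>hump_integral\<close>) turns both integrals into twice the integral of \<open>crest_density h\<close> from
  \<open>0\<close> to \<open>m\<close> (\<open>Q_bar_eq_crest_integral\<close>, \<open>wave_Q_eq_crest_integral\<close>).\<close>

section \<open>Functions that cross zero only downwards\<close>

text \<open>If \<open>v\<close> crosses zero only downwards, it cannot come back: the first zero after a point where
  \<open>v\<close> is negative would be reached from below, against the negative derivative there.\<close>

lemma sign_after_downward_zero:
  fixes v v' :: "real \<Rightarrow> real"
  assumes I: "convex I"
    and dv: "\<And>x. x \<in> I \<Longrightarrow> (v has_real_derivative v' x) (at x)"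
    and neg: "\<And>x. x \<in> I \<Longrightarrow> v x = 0 \<Longrightarrow> v' x < 0"
    and z: "z \<in> I" "v z = 0" and x: "x \<in> I" "z < x"
  shows "v x < 0"
proof (rule ccontr)
  assume "\<not> v x < 0"
  then have vx: "0 \<le> v x" by simp
  have sub: "{z..x} \<subseteq> I"
    using closed_segment_subset[OF z(1) x(1) I] x by (simp add: closed_segment_eq_real_ivl)
  have cont: "continuous_on {z..x} v"
    by (meson DERIV_continuous_on dv has_field_derivative_at_within sub subsetD)
  obtain d where d: "d > 0" "\<And>h. 0 < h \<Longrightarrow> h < d \<Longrightarrow> v (z + h) < v z"
    using DERIV_neg_dec_right[OF dv[OF z(1)] neg[OF z]] by blast
  define w where "w = z + min (d/2) ((x - z)/2)"
  have w: "z < w" "w < x" and "w - z < d"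
    using d x z(2) by (auto simp: w_def min_def field_simps)
  then have vw: "v w < 0" using d(2)[of "w - z"] z(2) by simp
  \<comment> \<open>The least element of this compact set is the first zero after \<open>w\<close>.\<close>
  define Z where "Z = {y \<in> {w..x}. v y = 0}"
  have contw: "continuous_on {w..x} v"
    using cont by (rule continuous_on_subset) (use w in auto)
  have "compact Z"
    unfolding Z_def compact_eq_bounded_closed
    using continuous_closed_preimage_constant[OF contw closed_atLeastAtMost, of 0]
    by (auto intro: bounded_subset[OF bounded_closed_interval[of w x]])
  moreover have "Z \<noteq> {}"
    using IVT'[of v w 0 x] vw vx w contw by (auto simp: Z_def)
  ultimately obtain y where y: "y \<in> Z" "\<And>t. t \<in> Z \<Longrightarrow> y \<le> t"
    using compact_attains_inf[of Z] by metis
  have yw: "w < y" "y \<le> x" "v y = 0" "y \<in> I"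
    using y(1) vw sub w by (auto simp: Z_def less_le)
  obtain e where e: "e > 0" "\<And>h. 0 < h \<Longrightarrow> h < e \<Longrightarrow> v y < v (y - h)"
    using DERIV_neg_dec_left[OF dv[OF yw(4)] neg[OF yw(4,3)]] by blast
  define t where "t = y - min (e/2) ((y - w)/2)"
  have t: "w < t" "t < y" and "y - t < e"
    using e yw by (auto simp: t_def min_def field_simps)
  then have vt: "v t > 0" using e(2)[of "y - t"] yw(3) by simp
  have "continuous_on {w..t} v"
    using contw by (rule continuous_on_subset) (use t yw in auto)
  then obtain r where "w \<le> r" "r \<le> t" "v r = 0"
    using IVT'[of v w 0 t] vw vt t by auto
  then show False
    using y(2)[of r] t yw by (auto simp: Z_def)
qed

text \<open>The reflection \<open>t \<mapsto> - v (- t)\<close> also crosses zero only downwards, which exchanges the two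
  sides of the zero.\<close>

lemma sign_before_downward_zero:
  fixes v v' :: "real \<Rightarrow> real"
  assumes I: "convex I"
    and dv: "\<And>x. x \<in> I \<Longrightarrow> (v has_real_derivative v' x) (at x)"
    and neg: "\<And>x. x \<in> I \<Longrightarrow> v x = 0 \<Longrightarrow> v' x < 0"
    and z: "z \<in> I" "v z = 0" and x: "x \<in> I" "x < z"
  shows "0 < v x"
proof -
  define v2 where "v2 = (\<lambda>t. - v (- t))"
  have dv2: "(v2 has_real_derivative v' (- t)) (at t)" if "t \<in> uminus ` I" for t
  proof -
    have "(v has_real_derivative v' (- t)) (at (- t))" using that dv by auto
    from DERIV_minus[OF DERIV_chain2[OF this DERIV_minus[OF DERIV_ident]]]
    show ?thesis by (simp add: v2_def)
  qed
  have "v2 (- x) < 0"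
    by (rule sign_after_downward_zero[where I = "uminus ` I" and z = "- z", OF _ dv2])
       (use assms convex_negations[OF I] in \<open>auto simp: v2_def\<close>)
  then show ?thesis by (simp add: v2_def)
qed

section \<open>Integrals along a profile with a single crest\<close>

lemma image_eq_open_interval:
  fixes u :: "real \<Rightarrow> real"
  assumes "connected A" "continuous_on A u" and sub: "u ` A \<subseteq> {l<..<m}"
    and low: "\<And>e. l < e \<Longrightarrow> \<exists>x\<in>A. u x < e" and high: "\<And>e. e < m \<Longrightarrow> \<exists>x\<in>A. e < u x"
  shows "u ` A = {l<..<m}"
proof
  show "{l<..<m} \<subseteq> u ` A"
  proof
    fix y assume y: "y \<in> {l<..<m}"
    obtain x where x: "x \<in> A" "u x < y" using low[of y] y by force
    obtain x' where x': "x' \<in> A" "y < u x'" using high[of y] y by force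
    have "connected (u ` A)"
      using assms by (intro connected_continuous_image)
    then show "y \<in> u ` A"
      by (rule connectedD_interval[of _ "u x" "u x'"]) (use x x' in simp_all)
  qed
qed (fact sub)

text \<open>The common mechanism behind both integrals. A positive profile \<open>u\<close> whose critical points are all
  strict maxima has only the crest \<open>x0\<close>, so it is a bijection from either flank onto the interval
  below the crest value. On each flank \<open>y = u x\<close> is an admissible change of variables, with
  \<open>\<bar>v x\<bar> dx = dy\<close>; the crest itself is a null set, where \<open>H\<close> may differ from
  \<open>\<bar>v\<bar> * G \<circ> u\<close>. The result depends on the parametrisation only through \<open>G\<close> and the crest value,
  which is what allows two different parametrisations of the same orbit to be compared. Integrability
  is stated as an equivalence because it is evident for one of them only.\<close>

lemma hump_integral:
  fixes u v v' G H :: "real \<Rightarrow> real"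
  assumes I: "open I" "convex I"
    and du: "\<And>x. x \<in> I \<Longrightarrow> (u has_real_derivative v x) (at x)"
    and dv: "\<And>x. x \<in> I \<Longrightarrow> (v has_real_derivative v' x) (at x)"
    and neg: "\<And>x. x \<in> I \<Longrightarrow> v x = 0 \<Longrightarrow> v' x < 0"
    and x0: "x0 \<in> I" "v x0 = 0"
    and pos: "\<And>x. x \<in> I \<Longrightarrow> 0 < u x"
    and low: "\<And>e. 0 < e \<Longrightarrow> \<exists>x\<in>I. x < x0 \<and> u x < e" "\<And>e. 0 < e \<Longrightarrow> \<exists>x\<in>I. x0 < x \<and> u x < e"
    and H: "\<And>x. x \<in> I \<Longrightarrow> v x \<noteq> 0 \<Longrightarrow> \<bar>v x\<bar> * G (u x) = H x"
  shows "H absolutely_integrable_on I \<longleftrightarrow> G absolutely_integrable_on {0<..<u x0}"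
    and "G absolutely_integrable_on {0<..<u x0} \<Longrightarrow> integral I H = 2 * integral {0<..<u x0} G"
proof -
  let ?A = "I \<inter> {..<x0}" and ?B = "I \<inter> {x0<..}" and ?J = "{0<..<u x0}"
  have vA: "0 < v x" if "x \<in> ?A" for x
    by (rule sign_before_downward_zero[where I = I and v' = v' and z = x0])
       (use I dv neg x0 that in simp_all)
  have vB: "v x < 0" if "x \<in> ?B" for x
    by (rule sign_after_downward_zero[where I = I and v' = v' and z = x0])
       (use I dv neg x0 that in simp_all)
  have cont: "continuous_on I u"
    by (meson DERIV_continuous_on du has_field_derivative_at_within)
  have seg: "{x..y} \<subseteq> I" if "x \<in> I" "y \<in> I" for x y
    using closed_segment_subset[OF that I(2)] by (cases "x \<le> y") (auto simp: closed_segment_eq_real_ivl)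
  have incr: "u x < u y" if xy: "x < y" "x \<in> I" "y \<in> I" "y \<le> x0" for x y
  proof -
    have sub: "{x..y} \<subseteq> I" using seg xy by simp
    have "\<exists>l. (u has_real_derivative l) (at t) \<and> 0 < l" if t: "x < t" "t < y" for t
    proof -
      have "t \<in> I" using sub t by auto
      then show ?thesis using du[of t] vA[of t] t xy(4) by (intro exI[of _ "v t"]) simp
    qed
    then show ?thesis
      using DERIV_pos_imp_increasing_open[OF xy(1) _ continuous_on_subset[OF cont sub]] by blast
  qed
  have decr: "u y < u x" if xy: "x < y" "x \<in> I" "y \<in> I" "x0 \<le> x" for x y
  proof -
    have sub: "{x..y} \<subseteq> I" using seg xy by simp
    have "\<exists>l. (u has_real_derivative l) (at t) \<and> l < 0" if t: "x < t" "t < y" for t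
    proof -
      have "t \<in> I" using sub t by auto
      then show ?thesis using du[of t] vB[of t] t xy(4) by (intro exI[of _ "v t"]) simp
    qed
    then show ?thesis
      using DERIV_neg_imp_decreasing_open[OF xy(1) _ continuous_on_subset[OF cont sub]] by blast
  qed
  have near: "\<exists>d>0. \<forall>x. dist x x0 < d \<longrightarrow> x \<in> I \<and> e < u x" if "e < u x0" for e
  proof -
    have "isCont u x0" using du x0 DERIV_isCont by blast
    then have "\<forall>\<^sub>F x in nhds x0. e < u x"
      using that by (intro order_tendstoD(1)[of u "u x0"]) (simp_all add: continuous_at tendsto_at_iff_tendsto_nhds)
    moreover have "\<forall>\<^sub>F x in nhds x0. x \<in> I"
      using I(1) x0(1) by (rule eventually_nhds_in_open)
    ultimately show ?thesis
      unfolding eventually_nhds_metric[symmetric] by (intro eventually_conj)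
  qed
  have imgA: "u ` ?A = ?J"
  proof (rule image_eq_open_interval)
    show "connected ?A"
      using I(2) by (intro convex_connected convex_Int) auto
    show "continuous_on ?A u" using cont by (rule continuous_on_subset) auto
    show "u ` ?A \<subseteq> ?J" using pos incr x0 by auto
    show "\<exists>x\<in>?A. u x < e" if "0 < e" for e using low(1)[OF that] by blast
    show "\<exists>x\<in>?A. e < u x" if lt: "e < u x0" for e
    proof -
      obtain d where "d > 0" "\<And>x. dist x x0 < d \<Longrightarrow> x \<in> I \<and> e < u x" using near[OF lt] by blast
      then show ?thesis by (intro bexI[of _ "x0 - d/2"]) (auto simp: dist_real_def)
    qed
  qed
  have imgB: "u ` ?B = ?J"
  proof (rule image_eq_open_interval)
    show "connected ?B"
      using I(2) by (intro convex_connected convex_Int) auto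
    show "continuous_on ?B u" using cont by (rule continuous_on_subset) auto
    show "u ` ?B \<subseteq> ?J" using pos decr x0 by auto
    show "\<exists>x\<in>?B. u x < e" if "0 < e" for e using low(2)[OF that] by blast
    show "\<exists>x\<in>?B. e < u x" if lt: "e < u x0" for e
    proof -
      obtain d where "d > 0" "\<And>x. dist x x0 < d \<Longrightarrow> x \<in> I \<and> e < u x" using near[OF lt] by blast
      then show ?thesis by (intro bexI[of _ "x0 + d/2"]) (auto simp: dist_real_def)
    qed
  qed
  have inj: "inj_on u ?A" "inj_on u ?B"
    using incr decr by (auto intro!: linorder_inj_onI' simp: less_imp_neq less_imp_neq[symmetric])
  have meas: "?A \<in> sets lebesgue" "?B \<in> sets lebesgue"
    using I(1) by (auto intro!: lebesgue_openin simp: open_Int)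
  have cv: "(H absolutely_integrable_on S \<and> integral S H = b) \<longleftrightarrow>
      (G absolutely_integrable_on ?J \<and> integral ?J G = b)"
    if S: "S = ?A \<or> S = ?B" for S b
  proof -
    have vS: "v x \<noteq> 0" "x \<in> I" if "x \<in> S" for x using that S vA vB by fastforce+
    have "(H absolutely_integrable_on S) = ((\<lambda>x. \<bar>v x\<bar> * G (u x)) absolutely_integrable_on S)"
      by (rule set_integrable_cong) (use H vS in auto)
    moreover have "integral S H = integral S (\<lambda>x. \<bar>v x\<bar> * G (u x))"
      by (rule integral_cong) (use H vS in auto)
    moreover have "u ` S = ?J" "S \<in> sets lebesgue" "inj_on u S"
      using S imgA imgB meas inj by auto
    ultimately show ?thesis
      using has_absolute_integral_change_of_variables_1'[of S u v G b] du vS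
      by (simp add: has_field_derivative_at_within)
  qed
  have split: "I = (?A \<union> ?B) \<union> {x0}" using x0 by auto
  show *: "H absolutely_integrable_on I \<longleftrightarrow> G absolutely_integrable_on ?J"
  proof
    assume "H absolutely_integrable_on I"
    then have "H absolutely_integrable_on ?A" by (rule set_integrable_subset) (use meas in auto)
    then show "G absolutely_integrable_on ?J" using cv[of ?A] by blast
  next
    assume "G absolutely_integrable_on ?J"
    then have "H absolutely_integrable_on ?A" "H absolutely_integrable_on ?B" using cv by blast+
    then have "H absolutely_integrable_on (?A \<union> ?B) \<union> {x0}"
      using absolutely_integrable_negligible[OF negligible_sing[of x0], of H]
      by (intro absolutely_integrable_Un)
    then show "H absolutely_integrable_on I" using split by simp
  qed
  assume G: "G absolutely_integrable_on ?J"
  then have AB: "H absolutely_integrable_on ?A" "integral ?A H = integral ?J G"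
      "H absolutely_integrable_on ?B" "integral ?B H = integral ?J G" using cv by blast+
  have "integral I H = integral (?A \<union> ?B) H"
    by (rule integral_subset_negligible[symmetric]) (use x0 in \<open>auto intro: negligible_subset[OF negligible_sing[of x0]]\<close>)
  also have "\<dots> = integral ?A H + integral ?B H"
  proof (rule integral_Un)
    have "?A \<inter> ?B = {}" by auto
    then show "negligible (?A \<inter> ?B)" by simp
  qed (use AB set_lebesgue_integral_eq_integral(1) in blast)+
  finally show "integral I H = 2 * integral ?J G" using AB by simp
qed

lemma LBINT_eq_integral:
  fixes f :: "real \<Rightarrow> real"
  assumes "S \<in> sets borel" "continuous_on S f" "f absolutely_integrable_on S"
  shows "(LBINT x:S. f x) = integral S f"
proof (rule set_borel_integral_eq_integral(2))
  show "set_integrable lborel S f"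
    using assms(3) borel_measurable_continuous_on_indicator[OF assms(1,2)]
    unfolding set_integrable_def by (simp add: integrable_completion)
qed

section \<open>The logarithmic remainder and the crest height\<close>

text \<open>The remainder of \<open>- ln (1 - y)\<close> after its linear Taylor term; its derivative is
  \<open>y / (1 - y)\<close>.\<close>

definition log_rem :: "real \<Rightarrow> real" where
  "log_rem y = - y - ln (1 - y)"

lemma log_rem_pos:
  assumes "y < 1" "y \<noteq> 0" shows "0 < log_rem y"
proof -
  have "ln (1 - y) \<le> (1 - y) - 1" using assms by (intro ln_le_minus_one) auto
  moreover have "ln (1 - y) \<noteq> (1 - y) - 1" using assms ln_eq_minus_one[of "1 - y"] by auto
  ultimately show ?thesis by (simp add: log_rem_def)
qed

lemma has_real_derivative_log_rem [derivative_intros]: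
  assumes "(g has_real_derivative g') (at x within S)" "g x < 1"
  shows "((\<lambda>x. log_rem (g x)) has_real_derivative g' * g x / (1 - g x)) (at x within S)"
  unfolding log_rem_def using assms by (auto intro!: derivative_eq_intros simp: field_simps)

text \<open>The function vanishes at zero, and its derivative is twice the logarithmic remainder.\<close>

lemma arc_f_pos:
  assumes "0 < y" "y < 1" shows "0 < arc_f y"
proof -
  have "arc_f 0 < arc_f y"
  proof (rule DERIV_pos_imp_increasing_open[OF assms(1)])
    show "\<exists>l. (arc_f has_real_derivative l) (at t) \<and> 0 < l" if t: "0 < t" "t < y" for t
    proof -
      have "t < 1" using t assms by simp
      then have "(arc_f has_real_derivative
          1 + (- 1 * (t + 2 * ln (1 - t)) + (1 - 2 * (1 / (1 - t))) * (1 - t))) (at t)"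
        unfolding arc_f_def by (auto intro!: derivative_eq_intros)
      moreover have "1 + (- 1 * (t + 2 * ln (1 - t)) + (1 - 2 * (1 / (1 - t))) * (1 - t)) = 2 * log_rem t"
        using \<open>t < 1\<close> by (simp add: log_rem_def field_simps)
      ultimately show ?thesis using log_rem_pos[of t] t \<open>t < 1\<close> by auto
    qed
    show "continuous_on {0..y} arc_f"
      unfolding arc_f_def using assms by (intro continuous_intros) auto
  qed
  then show ?thesis by (simp add: arc_f_def)
qed

text \<open>In this form the function appears as the numerator both in the derivative of
  \<open>y\<^sup>2 / log_rem y\<close> and in the acceleration at a crest.\<close>

lemma arc_f_eq: "arc_f y = y\<^sup>2 - 2 * (1 - y) * log_rem y"
  by (simp add: arc_f_def log_rem_def power2_eq_square algebra_simps)

lemma square_over_log_rem_decreasing: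
  assumes "0 < x" "x < y" "y < 1"
  shows "y\<^sup>2 / log_rem y < x\<^sup>2 / log_rem x"
proof (rule DERIV_neg_imp_decreasing[OF assms(2)])
  fix t assume "x \<le> t" "t \<le> y"
  then have t: "0 < t" "t < 1" and L: "0 < log_rem t" using assms log_rem_pos[of t] by auto
  have "((\<lambda>t. t\<^sup>2 / log_rem t) has_real_derivative - (t * arc_f t / ((1 - t) * (log_rem t)\<^sup>2))) (at t)"
    using t L unfolding arc_f_eq
    by (auto intro!: derivative_eq_intros simp: field_simps power2_eq_square)
  then show "\<exists>l. ((\<lambda>t. t\<^sup>2 / log_rem t) has_real_derivative l) (at t) \<and> l < 0"
    using t L arc_f_pos[OF t] by (intro exI conjI) auto
qed

text \<open>At a crest the velocity vanishes, and the energy identity reduces to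
  \<open>y\<^sup>2 = h * log_rem y\<close>. Hence \<open>h\<close> alone determines the height of the crest.\<close>

lemma crest_unique:
  assumes "0 < x" "x < 1" "0 < y" "y < 1" "x\<^sup>2 = h * log_rem x" "y\<^sup>2 = h * log_rem y"
  shows "x = y"
proof -
  have "x\<^sup>2 / log_rem x = y\<^sup>2 / log_rem y"
    using assms log_rem_pos[of x] log_rem_pos[of y] by simp
  then show ?thesis
    using assms square_over_log_rem_decreasing[of x y] square_over_log_rem_decreasing[of y x]
    by (metis less_irrefl linorder_neqE)
qed

text \<open>The integrand that both functionals acquire when the amplitude \<open>y\<close> is the variable of
  integration. The radicand is the square of the velocity of the rescaled wave at amplitude \<open>y\<close>, and
  it vanishes at the crest.\<close>

definition crest_density :: "real \<Rightarrow> real \<Rightarrow> real" where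
  "crest_density h y = log_rem y / ((1 - y) * sqrt (y\<^sup>2 - h * log_rem y))"

section \<open>The arc integral in the amplitude variable\<close>

text \<open>The velocity \<open>2 * s\<close> of the arc is positive near the start and negative near the end, so it
  vanishes somewhere, and the sign of \<open>arc_f\<close> makes every zero a downward crossing. The parameter
  interval is bounded and the integrand stays bounded because \<open>p\<close> never exceeds its crest value below
  \<open>1\<close>. This gives integrability here, and through the amplitude variable also for the integral over
  the unbounded wave, so it is part of the conclusion.\<close>

lemma Q_bar_eq_crest_integral:
  assumes tr: "traverses_Gamma h a b p s" and h: "h < 2"
  obtains m where "0 < m" "m < 1" "m\<^sup>2 = h * log_rem m"
    "crest_density h absolutely_integrable_on {0<..<m}"
    "Q_bar a b p = 2 * integral {0<..<m} (crest_density h)"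
proof -
  let ?I = "{a<..<b}"
  have ab: "a < b" and img: "(\<lambda>t. (p t, s t)) ` ?I = Gamma_curve h"
    and dp: "\<And>t. t \<in> ?I \<Longrightarrow> (p has_real_derivative 2 * s t) (at t)"
    and ds: "\<And>t. t \<in> ?I \<Longrightarrow> (s has_real_derivative
           - (p t * arc_f (p t)) / ((1 - p t) * (log_rem (p t))\<^sup>2)) (at t)"
    and lim: "(p \<longlongrightarrow> 0) (at_right a)" "(s \<longlongrightarrow> sqrt (2 - h)) (at_right a)"
       "(p \<longlongrightarrow> 0) (at_left b)" "(s \<longlongrightarrow> - sqrt (2 - h)) (at_left b)"
    using tr unfolding traverses_Gamma_def log_rem_def by auto
  have pr: "0 < p t" "p t < 1" "(s t)\<^sup>2 = ((p t)\<^sup>2 - h * log_rem (p t)) / log_rem (p t)"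
      "0 < log_rem (p t)" if "t \<in> ?I" for t
  proof -
    have "(p t, s t) \<in> Gamma_curve h" using that img by auto
    then have *: "0 < p t" "p t < 1" "- (s t)\<^sup>2 - (p t)\<^sup>2 / (p t + ln (1 - p t)) = h"
      by (auto simp: Gamma_curve_def)
    then show "0 < p t" "p t < 1" and L: "0 < log_rem (p t)" using log_rem_pos[of "p t"] by auto
    have "p t + ln (1 - p t) = - log_rem (p t)" by (simp add: log_rem_def)
    with *(3) have "(s t)\<^sup>2 = (p t)\<^sup>2 / log_rem (p t) - h" by simp
    then show "(s t)\<^sup>2 = ((p t)\<^sup>2 - h * log_rem (p t)) / log_rem (p t)"
      using L by (simp add: field_simps)
  qed
  have near_a: "\<exists>t\<in>?I. t < d \<and> P t" if "\<forall>\<^sub>F t in at_right a. P t" "d \<in> ?I \<or> d = b" for P d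
  proof -
    have "\<forall>\<^sub>F t in at_right a. t \<in> {a<..<d}"
      using that(2) ab by (intro eventually_at_right_real) auto
    from eventually_happens'[OF trivial_limit_at_right_real eventually_conj[OF that(1) this]]
    obtain t where "P t" "t \<in> {a<..<d}" by blast
    then show ?thesis using that(2) by (intro bexI[of _ t]) auto
  qed
  have near_b: "\<exists>t\<in>?I. d < t \<and> P t" if "\<forall>\<^sub>F t in at_left b. P t" "d \<in> ?I" for P d
  proof -
    have "\<forall>\<^sub>F t in at_left b. t \<in> {d<..<b}"
      using that(2) by (intro eventually_at_left_real) auto
    from eventually_happens'[OF trivial_limit_at_left_real eventually_conj[OF that(1) this]]
    obtain t where "P t" "t \<in> {d<..<b}" by blast
    then show ?thesis using that(2) by (intro bexI[of _ t]) auto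
  qed
  have "\<forall>\<^sub>F t in at_right a. 0 < s t"
    using h by (intro order_tendstoD(1)[OF lim(2)]) simp
  from near_a[OF this, of b] obtain t1 where t1: "t1 \<in> ?I" "0 < s t1" by blast
  have "\<forall>\<^sub>F t in at_left b. s t < 0"
    using h by (intro order_tendstoD(2)[OF lim(4)]) simp
  from near_b[OF this t1(1)] obtain t2 where t2: "t2 \<in> ?I" "t1 < t2" "s t2 < 0" by blast
  have conts: "continuous_on ?I s" and contp: "continuous_on ?I p"
    by (rule DERIV_continuous_on, rule has_field_derivative_at_within, erule ds dp)+
  have "continuous_on {t1..t2} s" using conts by (rule continuous_on_subset) (use t1 t2 in auto)
  then obtain t0 where "t1 \<le> t0" "t0 \<le> t2" "s t0 = 0"
    using IVT2'[of s t2 0 t1] t1 t2 by auto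
  then have t0: "t0 \<in> ?I" "s t0 = 0" using t1 t2 by auto
  define m where "m = p t0"
  have m: "0 < m" "m < 1" "m\<^sup>2 = h * log_rem m" using pr[OF t0(1)] t0(2) by (auto simp: m_def)
  define v' where "v' = (\<lambda>t. 2 * (- (p t * arc_f (p t)) / ((1 - p t) * (log_rem (p t))\<^sup>2)))"
  define H where "H = (\<lambda>t. 2 * (sqrt (log_rem (p t)) / (1 - p t)))"
  have neg: "v' t < 0" if "t \<in> ?I" for t
    using pr[OF that] arc_f_pos[of "p t"] by (simp add: v'_def divide_neg_pos)
  have dv: "((\<lambda>t. 2 * s t) has_real_derivative v' t) (at t)" if "t \<in> ?I" for t
    unfolding v'_def using ds[OF that] by (rule DERIV_cmult)
  have low1: "\<exists>t\<in>?I. t < t0 \<and> p t < e" if "0 < e" for e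
    using near_a[OF order_tendstoD(2)[OF lim(1) that], of t0] t0(1) by blast
  have low2: "\<exists>t\<in>?I. t0 < t \<and> p t < e" if "0 < e" for e
    using near_b[OF order_tendstoD(2)[OF lim(3) that] t0(1)] .
  have HG: "\<bar>2 * s t\<bar> * crest_density h (p t) = H t" if t: "t \<in> ?I" "2 * s t \<noteq> 0" for t
  proof -
    define L D where "L = log_rem (p t)" and "D = (p t)\<^sup>2 - h * log_rem (p t)"
    have s2: "(s t)\<^sup>2 = D / L" and L: "0 < L" using pr[OF t(1)] by (auto simp: L_def D_def)
    then have "0 < D / L" using t(2) by (metis mult_zero_right zero_less_power2)
    then have D: "0 < D" using L by (simp add: zero_less_divide_iff)
    have "\<bar>s t\<bar> = sqrt D / sqrt L" using s2 by (metis real_sqrt_abs real_sqrt_divide)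
    then have "\<bar>2 * s t\<bar> * crest_density h (p t) = 2 * (sqrt D / sqrt L) * (L / ((1 - p t) * sqrt D))"
      by (simp add: crest_density_def L_def D_def abs_mult)
    also have "\<dots> = 2 * ((L / sqrt L) / (1 - p t))" using D L by simp
    also have "L / sqrt L = sqrt L" using L by (simp add: real_div_sqrt)
    finally show ?thesis by (simp add: H_def L_def)
  qed
  have oc: "open ?I" "convex ?I" and d0: "2 * s t0 = 0" using t0 by auto
  have neg': "2 * s t = 0 \<Longrightarrow> v' t < 0" if "t \<in> ?I" for t using neg[OF that] .
  note prems = oc dp dv neg' t0(1) d0 pr(1) low1 low2 HG
  have hump: "H absolutely_integrable_on ?I \<longleftrightarrow> crest_density h absolutely_integrable_on {0<..<p t0}"
    by (rule hump_integral(1)[where v = "\<lambda>t. 2 * s t" and v' = v' and u = p]) (rule prems; assumption?)+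
  have hump2: "integral ?I H = 2 * integral {0<..<p t0} (crest_density h)"
    if "crest_density h absolutely_integrable_on {0<..<p t0}"
    using that
    by (rule hump_integral(2)[where v = "\<lambda>t. 2 * s t" and v' = v' and u = p, rotated -1]) (rule prems; assumption?)+
  have contH: "continuous_on ?I H"
    unfolding H_def log_rem_def using pr contp by (force intro!: continuous_intros)
  \<comment> \<open>Above the crest height \<open>p\<^sup>2 / log_rem p\<close> would be less than \<open>h\<close>, making \<open>s\<^sup>2\<close> negative.\<close>
  have le_m: "p t \<le> m" if t: "t \<in> ?I" for t
  proof (rule ccontr)
    assume "\<not> p t \<le> m"
    then have "(p t)\<^sup>2 / log_rem (p t) < m\<^sup>2 / log_rem m"
      using pr[OF t] m by (intro square_over_log_rem_decreasing) auto
    also have "\<dots> = h" using m log_rem_pos[of m] by simp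
    finally have "(p t)\<^sup>2 - h * log_rem (p t) < 0" using pr(4)[OF t] by (simp add: field_simps)
    then have "(s t)\<^sup>2 < 0" using pr[OF t] by (simp add: divide_neg_pos)
    then show False by simp
  qed
  have "continuous_on {0..m} (\<lambda>y. 2 * (sqrt (log_rem y) / (1 - y)))"
    unfolding log_rem_def using m by (auto intro!: continuous_intros)
  then have "bounded ((\<lambda>y. 2 * (sqrt (log_rem y) / (1 - y))) ` {0..m})"
    by (intro compact_imp_bounded compact_continuous_image) auto
  then obtain B where B: "\<And>y. y \<in> {0..m} \<Longrightarrow> norm (2 * (sqrt (log_rem y) / (1 - y))) \<le> B"
    unfolding bounded_iff by blast
  have HI: "H absolutely_integrable_on ?I"
  proof (rule measurable_bounded_by_integrable_imp_absolutely_integrable)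
    show "H \<in> borel_measurable (lebesgue_on ?I)"
      using contH by (rule continuous_imp_measurable_on_sets_lebesgue) auto
    show "(\<lambda>_. B) integrable_on ?I"
      using integrable_on_const[of "?I" B] by (simp add: fmeasurableI)
    show "norm (H t) \<le> B" if "t \<in> ?I" for t
      unfolding H_def using pr[OF that] le_m[OF that] by (intro B) auto
  qed auto
  have "Q_bar a b p = (LBINT t:?I. H t)"
    unfolding Q_bar_def H_def log_rem_def by (rule set_integral_mult_right[symmetric])
  also have "\<dots> = integral ?I H" using contH HI by (intro LBINT_eq_integral) auto
  finally show ?thesis
    using that[OF m] HI hump hump2 by (simp add: m_def)
qed

section \<open>The wave integral in the amplitude variable\<close>

text \<open>After rescaling to \<open>u = (\<phi> - \<kappa>) / (c - \<kappa>)\<close> the profile equation becomes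
  \<open>u'' = u - h / 2 * (u / (1 - u))\<close>, with the first integral
  \<open>u'\<^sup>2 - u\<^sup>2 + h * log_rem u\<close>. Decay at infinity shows that this constant is zero. The velocity as
  a function of the amplitude is then known, the critical point at the origin is the only crest, and
  its height is the one forced by \<open>h\<close>.\<close>

lemma wave_Q_eq_crest_integral:
  assumes k: "0 < \<kappa>" "\<kappa> < c / 2" and h: "h = 2 * \<kappa> / (c - \<kappa>)"
    and sol: "solitary_profile \<kappa> c \<phi>"
    and m: "0 < m" "m < 1" "m\<^sup>2 = h * log_rem m"
    and G: "crest_density h absolutely_integrable_on {0<..<m}"
  shows "wave_Q \<kappa> \<phi> c = 2 * integral {0<..<m} (crest_density h)"
proof -
  define \<phi>1 where "\<phi>1 = deriv \<phi>"
  have sm: "smooth \<phi>" and ode: "\<And>x. deriv \<phi>1 x = \<phi> x - \<kappa> * (c - \<kappa>) / (c - \<phi> x)"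
    and rng: "\<And>x. \<kappa> < \<phi> x" "\<And>x. \<phi> x < c" and crit: "\<phi>1 0 = 0"
    using sol by (auto simp: solitary_profile_def \<phi>1_def algebra_simps)
  obtain C \<delta> where "0 < \<delta>" and dec: "\<And>x. \<bar>\<phi> x - \<kappa>\<bar> \<le> C * exp (- \<delta> * \<bar>x\<bar>)"
    using sol unfolding solitary_profile_def by blast
  have ck: "0 < c - \<kappa>" using k by simp
  have d1: "(\<phi> has_real_derivative \<phi>1 x) (at x)" for x
    using sm[unfolded smooth_def, rule_format, of 0 x]
    by (simp add: \<phi>1_def DERIV_deriv_iff_real_differentiable)
  have d2: "(\<phi>1 has_real_derivative \<phi> x - \<kappa> * (c - \<kappa>) / (c - \<phi> x)) (at x)" for x
    using sm[unfolded smooth_def, rule_format, of 1 x]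
    by (simp add: \<phi>1_def[symmetric] ode[symmetric] DERIV_deriv_iff_real_differentiable)
  define u v v' where "u = (\<lambda>x. (\<phi> x - \<kappa>) / (c - \<kappa>))" and "v = (\<lambda>x. \<phi>1 x / (c - \<kappa>))"
    and "v' = (\<lambda>x. u x - h / 2 * (u x / (1 - u x)))"
  have u: "0 < u x" "u x < 1" "0 < log_rem (u x)" for x
    using rng[of x] ck log_rem_pos[of "u x"] by (auto simp: u_def)
  have omu: "1 - u x = (c - \<phi> x) / (c - \<kappa>)" for x
    using ck by (simp add: u_def field_simps)
  have du: "(u has_real_derivative v x) (at x)" for x
    unfolding u_def v_def using DERIV_cdivide[OF DERIV_diff[OF d1[of x] DERIV_const]] by simp
  have dv: "(v has_real_derivative v' x) (at x)" for x
  proof -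
    have "(v has_real_derivative (\<phi> x - \<kappa> * (c - \<kappa>) / (c - \<phi> x)) / (c - \<kappa>)) (at x)"
      unfolding v_def using d2[of x] by (rule DERIV_cdivide)
    moreover have "(\<phi> x - \<kappa> * (c - \<kappa>) / (c - \<phi> x)) / (c - \<kappa>) = v' x"
      using ck rng[of x] unfolding v'_def omu h by (simp add: u_def divide_simps) (simp add: algebra_simps)
    ultimately show ?thesis by simp
  qed
  define E where "E = (\<lambda>x. (v x)\<^sup>2 - (u x)\<^sup>2 + h * log_rem (u x))"
  have dE: "(E has_real_derivative 0) (at x)" for x
  proof -
    have "(E has_real_derivative 2 * v x * v' x - 2 * u x * v x + h * (v x * (u x / (1 - u x)))) (at x)"
      unfolding E_def using u(2)[of x] by (auto intro!: derivative_eq_intros du dv)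
    moreover have "2 * V * (U - h / 2 * q) - 2 * U * V + h * (V * q) = 0" for U V q :: real
      by (simp add: algebra_simps)
    ultimately show ?thesis by (simp only: v'_def)
  qed
  have Ec: "E x = E y" for x y using DERIV_isconst_all dE by blast
  have lim_top: "(u \<longlongrightarrow> 0) at_top" and lim_bot: "(u \<longlongrightarrow> 0) at_bot"
  proof -
    have bound: "norm (u x) \<le> C * exp (- \<delta> * \<bar>x\<bar>) / (c - \<kappa>)" for x
      using dec[of x] ck by (simp add: u_def divide_right_mono)
    have top: "filterlim (\<lambda>x. \<delta> * \<bar>x\<bar>) at_top F" if "filterlim (\<lambda>x::real. \<bar>x\<bar>) at_top F" for F
      using filterlim_tendsto_pos_mult_at_top[OF tendsto_const \<open>0 < \<delta>\<close> that] .
    have *: "(u \<longlongrightarrow> 0) F" if "filterlim (\<lambda>x::real. \<bar>x\<bar>) at_top F" for F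
    proof (rule Lim_null_comparison[OF always_eventually])
      have "((\<lambda>x. exp (- (\<delta> * \<bar>x\<bar>))) \<longlongrightarrow> 0) F"
        using top[OF that] by (intro filterlim_compose[OF exp_at_bot] filterlim_compose[OF filterlim_uminus_at_bot_at_top])
      then show "((\<lambda>x. C * exp (- \<delta> * \<bar>x\<bar>) / (c - \<kappa>)) \<longlongrightarrow> 0) F"
        using tendsto_divide[OF tendsto_mult[OF tendsto_const] tendsto_const, of _ 0 F "c - \<kappa>" C] ck by simp
    qed (use bound in simp)
    show "(u \<longlongrightarrow> 0) at_top"
      by (intro * filterlim_at_top_mono[OF filterlim_ident always_eventually]) auto
    show "(u \<longlongrightarrow> 0) at_bot"
      by (intro * filterlim_at_top_mono[OF filterlim_uminus_at_top_at_bot always_eventually]) auto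
  qed
  have energy: "(v x)\<^sup>2 = (u x)\<^sup>2 - h * log_rem (u x)" for x
  proof -
    \<comment> \<open>The mean value theorem gives points tending to infinity where the velocity is a difference of
      values of \<open>u\<close>, hence tends to zero, although no limit of the velocity itself is known beforehand.\<close>
    have "\<exists>z. real n < z \<and> z < real n + 1 \<and> u (real n + 1) - u (real n) = v z" for n
      using MVT2[of "real n" "real n + 1" u v] du by auto
    then obtain z where z: "\<And>n. real n < z n" "\<And>n. u (real n + 1) - u (real n) = v (z n)"
      by metis
    have ztop: "filterlim z at_top sequentially"
      by (rule filterlim_at_top_mono[OF filterlim_real_sequentially]) (intro always_eventually allI less_imp_le z(1))
    have un: "(\<lambda>n. u (real n)) \<longlonglongrightarrow> 0" "(\<lambda>n. u (real n + 1)) \<longlonglongrightarrow> 0" "(\<lambda>n. u (z n)) \<longlonglongrightarrow> 0"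
      using filterlim_compose[OF lim_top filterlim_real_sequentially]
        filterlim_compose[OF lim_top ztop]
        filterlim_compose[OF lim_top filterlim_tendsto_add_at_top[OF tendsto_const filterlim_real_sequentially, of 1]]
      by (simp_all add: add.commute)
    have "(\<lambda>n. v (z n)) \<longlonglongrightarrow> 0"
      using tendsto_diff[OF un(2,1)] z(2) by simp
    then have "(\<lambda>n. E (z n)) \<longlonglongrightarrow> 0\<^sup>2 - 0\<^sup>2 + h * log_rem 0"
      unfolding E_def log_rem_def by (intro tendsto_intros un(3)) auto
    moreover have "(\<lambda>n. E (z n)) = (\<lambda>_. E x)" using Ec by blast
    ultimately have "E x = 0" by (simp add: log_rem_def LIMSEQ_const_iff)
    then show ?thesis by (simp add: E_def)
  qed
  have neg: "v' x < 0" if "v x = 0" for x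
  proof -
    have hu: "h = (u x)\<^sup>2 / log_rem (u x)" using energy[of x] that u[of x] by (simp add: field_simps)
    have "v' x = - (u x * arc_f (u x) / (2 * log_rem (u x) * (1 - u x)))"
      using u[of x] unfolding v'_def arc_f_eq hu by (simp add: field_simps power2_eq_square)
    then show ?thesis using u[of x] arc_f_pos[of "u x"] by simp
  qed
  have v0: "v 0 = 0" by (simp add: v_def crit)
  have u0: "u 0 = m"
    by (rule crest_unique[OF u(1,2) m(1,2) _ m(3)]) (use energy[of 0] v0 in simp)
  define H where "H = (\<lambda>x. log_rem (u x) / (1 - u x))"
  have low1: "\<exists>x\<in>UNIV. x < 0 \<and> u x < e" if e: "0 < e" for e
  proof -
    obtain N where "\<And>x. x \<le> N \<Longrightarrow> u x < e"
      using order_tendstoD(2)[OF lim_bot e] by (auto simp: eventually_at_bot_linorder)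
    then show ?thesis by (intro bexI[of _ "min N (- 1)"]) auto
  qed
  have low2: "\<exists>x\<in>UNIV. 0 < x \<and> u x < e" if e: "0 < e" for e
  proof -
    obtain N where "\<And>x. N \<le> x \<Longrightarrow> u x < e"
      using order_tendstoD(2)[OF lim_top e] by (auto simp: eventually_at_top_linorder)
    then show ?thesis by (intro bexI[of _ "max N 1"]) auto
  qed
  have HG: "\<bar>v x\<bar> * crest_density h (u x) = H x" if "v x \<noteq> 0" for x
    using that unfolding crest_density_def energy[symmetric] H_def by simp
  note prems = open_UNIV convex_UNIV du dv neg UNIV_I v0 u(1) low1 low2 HG
  have hump: "H absolutely_integrable_on UNIV \<longleftrightarrow> crest_density h absolutely_integrable_on {0<..<u 0}"
    by (rule hump_integral(1)[where v = v and v' = v' and u = u]) (rule prems; assumption?)+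
  have hump2: "integral UNIV H = 2 * integral {0<..<u 0} (crest_density h)"
    if "crest_density h absolutely_integrable_on {0<..<u 0}"
    using that
    by (rule hump_integral(2)[where v = v and v' = v' and u = u, rotated -1]) (rule prems; assumption?)+
  have "wave_Q \<kappa> \<phi> c = (LBINT x:UNIV. H x)"
  proof -
    have "(c - \<kappa>) / (c - \<phi> x) * ln ((c - \<kappa>) / (c - \<phi> x)) - (c - \<kappa>) / (c - \<phi> x) + 1 = H x" for x
    proof -
      have r: "(c - \<kappa>) / (c - \<phi> x) = 1 / (1 - u x)" using omu[of x] by simp
      have "1 / w * - l - 1 / w + 1 = (- (1 - w) - l) / w" if "0 < w" for w l :: real
        using that by (simp add: field_simps)
      from this[of "1 - u x" "ln (1 - u x)"] show ?thesis
        unfolding r H_def log_rem_def using u(2)[of x] by (simp add: ln_div)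
    qed
    then show ?thesis by (simp add: wave_Q_def set_lebesgue_integral_def)
  qed
  also have "\<dots> = integral UNIV H"
  proof (rule LBINT_eq_integral)
    have "continuous_on UNIV u"
      by (rule DERIV_continuous_on, rule has_field_derivative_at_within, rule du)
    moreover have "1 - u x \<noteq> 0" for x using u(2)[of x] by simp
    ultimately show "continuous_on UNIV H"
      unfolding H_def log_rem_def by (intro continuous_intros) auto
  qed (use hump G u0 in auto)
  finally show ?thesis using hump2 G u0 by simp
qed

section \<open>The two functionals agree\<close>

lemma wave_Q_eq_Q_bar:
  assumes "0 < \<kappa>" "\<kappa> < c / 2" "h = 2 * \<kappa> / (c - \<kappa>)" "solitary_profile \<kappa> c \<phi>"
    and tr: "traverses_Gamma h a b p s"
  shows "wave_Q \<kappa> \<phi> c = Q_bar a b p"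
proof -
  have "h < 2" using assms by (simp add: divide_less_eq)
  with tr show ?thesis
    by (rule Q_bar_eq_crest_integral) (use assms wave_Q_eq_crest_integral in simp)
qed

theorem lemma5p1:
  fixes \<kappa> c h :: real
    and \<phi> :: "real \<Rightarrow> real \<Rightarrow> real"
    and a b :: "real \<Rightarrow> real"
    and p s :: "real \<Rightarrow> real \<Rightarrow> real"
  assumes "0 < \<kappa>" and "\<kappa> < c / 2"
    and "h = 2 * \<kappa> / (c - \<kappa>)"
    and "\<And>c'. \<kappa> < c' / 2 \<Longrightarrow> solitary_profile \<kappa> c' (\<phi> c')"
    and "\<And>h'. 0 < h' \<Longrightarrow> h' < 2 \<Longrightarrow> traverses_Gamma h' (a h') (b h') (p h') (s h')"
  shows "(\<exists>D. ((\<lambda>c'. wave_Q \<kappa> (\<phi> c') c') has_real_derivative D) (at c) \<and> D > 0) \<longleftrightarrow>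
         (\<exists>D. ((\<lambda>h'. Q_bar (a h') (b h') (p h')) has_real_derivative D) (at h) \<and> D < 0)"
proof -
  define W B where "W = (\<lambda>c'. wave_Q \<kappa> (\<phi> c') c')" and "B = (\<lambda>h'. Q_bar (a h') (b h') (p h'))"
  \<comment> \<open>The change of parameter \<open>c \<mapsto> h\<close> and its inverse; both are strictly decreasing, which
    reverses the sign of the derivative.\<close>
  define \<eta> \<gamma> where "\<eta> = (\<lambda>c'. 2 * \<kappa> / (c' - \<kappa>))" and "\<gamma> = (\<lambda>h'. \<kappa> + 2 * \<kappa> / h')"
  have WB: "W c' = B (\<eta> c')" if "2 * \<kappa> < c'" for c'
  proof -
    have "0 < \<eta> c'" "\<eta> c' < 2" using that assms(1) by (auto simp: \<eta>_def divide_less_eq)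
    from assms(5)[OF this] show ?thesis unfolding W_def B_def
      using that assms(1,4) by (intro wave_Q_eq_Q_bar) (auto simp: \<eta>_def)
  qed
  have BW: "B h' = W (\<gamma> h')" if "0 < h'" "h' < 2" for h'
  proof -
    have "2 * \<kappa> < \<gamma> h'" "\<eta> (\<gamma> h') = h'" using that assms(1) by (auto simp: \<gamma>_def \<eta>_def field_simps)
    then show ?thesis using WB by simp
  qed
  have c: "2 * \<kappa> < c" and h: "h = \<eta> c" "0 < h" "h < 2" and ch: "\<gamma> h = c"
    using assms(1-3) by (auto simp: \<eta>_def \<gamma>_def divide_less_eq)
  have d\<eta>: "(\<eta> has_real_derivative - (2 * \<kappa> / (c - \<kappa>)\<^sup>2)) (at c)"
    unfolding \<eta>_def using c assms(1) by (auto intro!: derivative_eq_intros simp: power2_eq_square)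
  have d\<gamma>: "(\<gamma> has_real_derivative - (2 * \<kappa> / h\<^sup>2)) (at h)"
    unfolding \<gamma>_def using h by (auto intro!: derivative_eq_intros simp: power2_eq_square)
  have "\<exists>D'. (B has_real_derivative D') (at h) \<and> D' < 0"
    if "(W has_real_derivative D) (at c)" "D > 0" for D
  proof -
    have "((\<lambda>h'. W (\<gamma> h')) has_real_derivative D * - (2 * \<kappa> / h\<^sup>2)) (at h)"
      by (rule DERIV_chain2[OF _ d\<gamma>]) (use that ch in simp)
    then have "(B has_real_derivative D * - (2 * \<kappa> / h\<^sup>2)) (at h)"
      by (rule has_field_derivative_transform_within_open[where S = "{0<..<2}"]) (use h BW in auto)
    moreover have "D * - (2 * \<kappa> / h\<^sup>2) < 0" using that assms(1) h by (intro mult_pos_neg) auto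
    ultimately show ?thesis by blast
  qed
  moreover have "\<exists>D'. (W has_real_derivative D') (at c) \<and> D' > 0"
    if "(B has_real_derivative D) (at h)" "D < 0" for D
  proof -
    have "((\<lambda>c'. B (\<eta> c')) has_real_derivative D * - (2 * \<kappa> / (c - \<kappa>)\<^sup>2)) (at c)"
      by (rule DERIV_chain2[OF _ d\<eta>]) (use that h in simp)
    then have "(W has_real_derivative D * - (2 * \<kappa> / (c - \<kappa>)\<^sup>2)) (at c)"
      by (rule has_field_derivative_transform_within_open[where S = "{2 * \<kappa><..}"]) (use c WB in auto)
    moreover have "D * - (2 * \<kappa> / (c - \<kappa>)\<^sup>2) > 0" using that assms(1) c by (intro mult_neg_neg) auto
    ultimately show ?thesis by blast
  qed
  ultimately show ?thesis unfolding W_def B_def by blast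
qed

end
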